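(* For every integer $k > 1$ one has \[ \alpha\bigl(J(k^2-k+1,\,k,\,1)\bigr) = \binom{k^2-k-1}{k-2}. \]
   Context: For integers $n, k, t$, the (generalized) Johnson graph $J(n,k,t)$ (also written $J[n,k,t]$) is the graph whose vertices are the $k$-element subsets of an $n$-element set (e.g. $\{1,\dots,n\}$), and in which two distinct vertices are joined by an edge exactly when their intersection has exactly $t$ elements. An independent set of a graph is a set of vertices containing no edge. For a graph $G$, $\alpha(G)$ denotes the largest size of an independent set in $G$. Thus $\alpha(J(k^2-k+1,k,1))$ is the largest size of a family of $k$-subsets of a $(k^2-k+1)$-element set such that no two members of the family intersect in exactly one element. *)

theory Defs
  imports "HOL-Library.Ramsey"
begin

text \<open>A simple graph is a pair of a vertex set and a set of two-element edges; this is the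
  edge representation used by \<^const>\<open>indep\<close>.\<close>

type_synonym 'a graph = "'a set \<times> 'a set set"

definition johnson_graph :: "nat \<Rightarrow> nat \<Rightarrow> nat \<Rightarrow> nat set graph" where
  "johnson_graph n k t =
    (nsets {1..n} k,
     {{A, B} | A B. A \<in> nsets {1..n} k \<and> B \<in> nsets {1..n} k \<and> A \<noteq> B \<and> card (A \<inter> B) = t})"

definition independent_set :: "'a graph \<Rightarrow> 'a set \<Rightarrow> bool" where
  "independent_set G S \<longleftrightarrow> S \<subseteq> fst G \<and> indep S (snd G)"

text \<open>Meaningful for finite vertex sets only, since \<^const>\<open>Max\<close> is.\<close>

definition independence_number :: "'a graph \<Rightarrow> nat" where
  "independence_number G = Max {card S | S. independent_set G S}"

lemma finite_fst_johnson_graph: "finite (fst (johnson_graph n k t))"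
  by (simp add: johnson_graph_def finite_imp_finite_nsets)

lemma johnson_graph_edge_iff:
  assumes "A \<in> nsets {1..n} k" "B \<in> nsets {1..n} k" "A \<noteq> B"
  shows "{A, B} \<in> snd (johnson_graph n k t) \<longleftrightarrow> card (A \<inter> B) = t"
  using assms unfolding johnson_graph_def
  by (auto simp: doubleton_eq_iff Int_commute simp del: One_nat_def)

lemma independent_set_johnson_graph_iff:
  "independent_set (johnson_graph n k t) F \<longleftrightarrow>
    F \<subseteq> nsets {1..n} k \<and> (\<forall>A\<in>F. \<forall>B\<in>F. A \<noteq> B \<longrightarrow> card (A \<inter> B) \<noteq> t)"
proof -
  have "fst (johnson_graph n k t) = nsets {1..n} k"
    by (simp add: johnson_graph_def)
  then show ?thesis
    unfolding independent_set_def indep_def using johnson_graph_edge_iff by (metis subsetD)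
qed

lemma finite_card_independent_sets:
  assumes "finite (fst G)"
  shows "finite {card S | S. independent_set G S}"
proof -
  have "{card S | S. independent_set G S} \<subseteq> card ` Pow (fst G)"
    by (auto simp: independent_set_def)
  then show ?thesis
    using assms by (meson finite_Pow_iff finite_imageI finite_subset)
qed

lemma independence_number_attained:
  assumes "finite (fst G)"
  shows "\<exists>S. independent_set G S \<and> card S = independence_number G"
proof -
  have "independent_set G {}"
    by (simp add: independent_set_def)
  then have "independence_number G \<in> {card S | S. independent_set G S}"
    unfolding independence_number_def
    by (intro Max_in finite_card_independent_sets assms) auto
  then show ?thesis by auto
qed

lemma card_le_independence_number:
  assumes "finite (fst G)" "independent_set G S"
  shows "card S \<le> independence_number G"
  unfolding independence_number_def
  using assms by (intro Max_ge finite_card_independent_sets) auto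

end

theory Submission
  imports Defs "HOL-Analysis.Function_Topology" "HOL-Combinatorics.Transposition"
begin

text \<open>
Write \<open>n = k\<^sup>2 - k + 1\<close>. All \<open>k\<close>-sets through two fixed points form an independent set of size
\<open>n - 2 choose (k - 2)\<close>, which equals \<open>(n choose k) / n\<close> because \<open>n - 1 = k (k - 1)\<close>. If there is a
projective plane of order \<open>k - 1\<close>, its \<open>n\<close> lines form a clique, and since the graph is
vertex-transitive, no independent set can contain more than \<open>1 / n\<close> of all vertices. For general
\<open>k\<close> the missing plane is replaced by Hoffman's ratio bound. It gives the same value, because the
least eigenvalue of the graph is what the plane would force it to be: minus the valency divided by
\<open>n - 1\<close>.

In matrix form: let \<open>A\<close> be the adjacency matrix, \<open>\<tau>\<close> the valency divided by \<open>n - 1\<close>, and \<open>J\<close> the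
all-ones matrix. With \<open>c\<close> chosen so that \<open>M = A + \<tau> I - c J\<close> annihilates constants, \<open>M\<close> is
positive semidefinite (\<open>johnson_eigenvalue_nonneg\<close>), and evaluating its form at an indicator
function gives the bound (\<open>card_family_avoiding_intersection_1\<close>).

Semidefiniteness holds because the form of a symmetric matrix attains its minimum at an eigenvector
(\<open>minimal_eigenvector_exists\<close>) and every eigenvalue can be read off from a well-chosen
eigenfunction. Starting from any
eigenfunction, antisymmetrise it along disjoint pairs of points as long as the result is nonzero
(\<open>maximal_antisymmetrization\<close>). The final function changes sign when the points of a chosen pair
are swapped and is symmetric in all remaining points, so up to a scalar it is determined by the
pairs (\<open>value_on_transversals\<close>): it is the restriction to \<open>k\<close>-sets of the product of the
differences \<open>e a - e b\<close> over the pairs, \<open>e x\<close> being the indicator of containing \<open>x\<close>. If there are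
\<open>j\<close> pairs and \<open>m = n - k\<close>, counting the \<open>k\<close>-sets that meet a given one in a single point
(\<open>sum_over_sets_meeting_once\<close>) gives the eigenvalue
\<open>(-1) ^ j * ((k - j) * (m - j choose (k - j - 1)) - j * (m - j choose (k - j)))\<close>,
and an elementary estimate (\<open>planar_eigenvalue_bound\<close>), sharp for \<open>j = 1\<close> and \<open>j = 2\<close>, shows that
this is at least \<open>- \<tau>\<close> for \<open>j \<ge> 1\<close>.
\<close>

section \<open>Eigenvectors of real symmetric matrices\<close>

text \<open>A minimiser of the quadratic form on the unit sphere is an eigenvector: perturbing it in the
direction of one coordinate must not lower the Rayleigh quotient. The index set is a mere finite
set, so vectors are functions on its type, the topology is the product topology, and the sphere
is cut out of a product of compact intervals that are degenerate outside \<open>V\<close>.\<close>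

lemma minimal_eigenvector_exists:
  fixes K :: "'a \<Rightarrow> 'a \<Rightarrow> real"
  assumes fin: "finite V" and ne: "V \<noteq> {}"
    and sym: "\<And>x y. x \<in> V \<Longrightarrow> y \<in> V \<Longrightarrow> K x y = K y x"
  obtains lam f where "\<exists>x\<in>V. f x \<noteq> 0"
    and "\<forall>x\<in>V. (\<Sum>y\<in>V. K x y * f y) = lam * f x"
    and "\<And>g. lam * (\<Sum>x\<in>V. (g x)\<^sup>2) \<le> (\<Sum>x\<in>V. \<Sum>y\<in>V. K x y * g x * g y)"
proof -
  define Q where "Q g = (\<Sum>x\<in>V. \<Sum>y\<in>V. K x y * g x * g y)" for g
  define N where "N g = (\<Sum>x\<in>V. (g x)\<^sup>2)" for g :: "'a \<Rightarrow> real"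
  define B where "B = PiE UNIV (\<lambda>x. if x \<in> V then {-1..1::real} else {0})"
  have "compact B"
    unfolding B_def compactin_euclidean_iff[symmetric] euclidean_product_topology[symmetric] compactin_PiE
    by auto
  have contN: "continuous_on UNIV N" and contQ: "continuous_on UNIV Q"
    unfolding N_def Q_def by (intro continuous_intros continuous_on_product_coordinates)+
  have "closed {g. N g = 1}"
    using contN by (intro closed_Collect_eq continuous_intros) auto
  then have comp: "compact (B \<inter> {g. N g = 1})"
    using \<open>compact B\<close> by (rule compact_Int_closed[rotated])
  have sphere: "\<exists>h \<in> B \<inter> {g. N g = 1}. Q h = Q g / N g" if "N g \<noteq> 0" for g
  proof -
    define h where "h x = (if x \<in> V then g x / sqrt (N g) else 0)" for x
    have pos: "N g > 0"
      using that unfolding N_def by (simp add: order_less_le sum_nonneg)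
    have "N h = N g / N g"
      using pos unfolding N_def[of h] by (simp add: h_def power_divide flip: sum_divide_distrib N_def)
    then have "N h = 1" using pos by simp
    have "\<bar>h x\<bar> \<le> 1" if "x \<in> V" for x
      using member_le_sum[OF that, of "\<lambda>x. (h x)\<^sup>2"] fin \<open>N h = 1\<close> by (simp add: N_def abs_square_le_1)
    then have "h x \<in> {-1..1}" if "x \<in> V" for x
      using that by (simp add: abs_le_iff)
    moreover have "h x = 0" if "x \<notin> V" for x
      using that by (simp add: h_def)
    ultimately have "h \<in> B" by (auto simp: B_def)
    moreover have "Q h = Q g / N g"
      using pos unfolding Q_def
      by (simp add: h_def sum_divide_distrib)
    ultimately show ?thesis using \<open>N h = 1\<close> by auto
  qed
  have "N (\<lambda>_. 1) \<noteq> 0" using fin ne by (simp add: N_def)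
  then have "B \<inter> {g. N g = 1} \<noteq> {}" using sphere by blast
  from continuous_attains_inf[OF comp this continuous_on_subset[OF contQ]]
  obtain f where f: "N f = 1" and min: "\<And>h. h \<in> B \<Longrightarrow> N h = 1 \<Longrightarrow> Q f \<le> Q h" by auto
  have low: "Q f * N g \<le> Q g" for g
  proof (cases "N g = 0")
    case True
    then have "\<forall>x\<in>V. g x = 0"
      using fin unfolding N_def by (simp add: sum_nonneg_eq_0_iff)
    then show ?thesis using True by (simp add: Q_def)
  next
    case False
    then have pos: "N g > 0" by (simp add: N_def order_less_le sum_nonneg)
    have "Q f \<le> Q g / N g" using sphere[OF False] min by fastforce
    then show ?thesis using pos by (simp add: field_simps)
  qed
  have eig: "(\<Sum>y\<in>V. K x y * f y) = Q f * f x" if x: "x \<in> V" for x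
  proof (rule ccontr)
    define D where "D = (\<Sum>y\<in>V. K x y * f y) - Q f * f x"
    define c where "c = K x x - Q f"
    define s where "s = 1 / (\<bar>c\<bar> + 1)"
    \<comment> \<open>The perturbation changes the nonnegative form \<open>Q - (Q f) N\<close> by \<open>2 t D + t\<^sup>2 c\<close>; a step
      against the sign of \<open>D\<close>, short enough to keep the quadratic term small, makes it negative.\<close>
    define t where "t = - D * s"
    define d where "d y = (if y = x then 1 else 0 :: real)" for y
    assume "(\<Sum>y\<in>V. K x y * f y) \<noteq> Q f * f x"
    then have "D \<noteq> 0" by (simp add: D_def)
    have s: "s > 0" "s * c \<le> 1"
      unfolding s_def by (auto simp: field_simps)
    have "N (\<lambda>y. f y + t * d y) = N f + 2 * t * (\<Sum>y\<in>V. f y * d y) + t\<^sup>2 * (\<Sum>y\<in>V. d y)"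
      unfolding N_def sum_distrib_left sum.distrib[symmetric]
      by (intro sum.cong) (auto simp: d_def power2_eq_square algebra_simps)
    then have N': "N (\<lambda>y. f y + t * d y) = N f + 2 * t * f x + t\<^sup>2"
      using x fin by (simp add: d_def if_distrib cong: if_cong)
    have "Q (\<lambda>y. f y + t * d y) = Q f + t * (\<Sum>y\<in>V. \<Sum>z\<in>V. K y z * f y * d z)
        + t * (\<Sum>y\<in>V. \<Sum>z\<in>V. d y * (K y z * f z)) + t\<^sup>2 * (\<Sum>y\<in>V. \<Sum>z\<in>V. d y * (K y z * d z))"
      unfolding Q_def sum_distrib_left sum.distrib[symmetric]
      by (intro sum.cong) (auto simp: power2_eq_square algebra_simps)
    moreover have "(\<Sum>y\<in>V. \<Sum>z\<in>V. K y z * f y * d z) = (\<Sum>y\<in>V. K x y * f y)"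
      using x fin sym by (simp add: d_def if_distrib cong: if_cong)
    moreover have "(\<Sum>y\<in>V. \<Sum>z\<in>V. d y * (K y z * f z)) = (\<Sum>y\<in>V. K x y * f y)"
      unfolding sum_distrib_left[symmetric] using x fin by (simp add: d_def if_distrib if_distribR cong: if_cong)
    moreover have "(\<Sum>y\<in>V. \<Sum>z\<in>V. d y * (K y z * d z)) = K x x"
      unfolding sum_distrib_left[symmetric] using x fin by (simp add: d_def if_distrib if_distribR cong: if_cong)
    ultimately have "Q (\<lambda>y. f y + t * d y) - Q f * N (\<lambda>y. f y + t * d y) = 2 * t * D + t\<^sup>2 * c"
      unfolding N' f by (simp add: D_def c_def algebra_simps)
    then have "0 \<le> 2 * t * D + t\<^sup>2 * c" using low[of "\<lambda>y. f y + t * d y"] by simp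
    also have "\<dots> = s * D\<^sup>2 * (s * c - 2)"
      by (simp add: t_def power2_eq_square algebra_simps)
    also have "\<dots> < 0"
      using s \<open>D \<noteq> 0\<close> by (intro mult_pos_neg) auto
    finally show False by simp
  qed
  have "\<exists>x\<in>V. f x \<noteq> 0"
  proof (rule ccontr)
    assume "\<not> (\<exists>x\<in>V. f x \<noteq> 0)"
    then have "N f = 0" by (simp add: N_def)
    with f show False by simp
  qed
  with eig low show thesis by (intro that[of f "Q f"]) (auto simp: Q_def N_def)
qed

section \<open>Estimates for binomial coefficients\<close>

lemma Suc_times_binomial_Suc: "Suc q * (a choose Suc q) = (a - q) * (a choose q)"
  by (simp only: binomial_absorption binomial_absorb_comp)

lemma binomial_le_binomial_add: "(a choose b) \<le> ((a + i) choose (b + i))"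
proof (induction i)
  case (Suc i)
  then show ?case by (simp add: le_trans)
qed simp

text \<open>The inequality at the heart of the bound: no eigenvalue of \<open>J(k\<^sup>2 - k + 1, k, 1)\<close> lies below
\<open>- \<tau>\<close>, where \<open>\<tau> = (m - 1) choose (k - 2)\<close> is the valency divided by \<open>n - 1\<close>. The displayed
alternating expression is the eigenvalue of index \<open>j\<close>. For \<open>j = 1\<close> and \<open>j = 2\<close> it equals \<open>- \<tau>\<close>,
reflecting that the lines of a projective plane form a 2-design. For odd \<open>j \<ge> 3\<close> it is nonnegative
because \<open>(k - j)\<^sup>2 \<le> j (k - 1) (k - 2)\<close>, and for even \<open>j \<ge> 4\<close> its negative part alone is at most
\<open>\<tau>\<close>.\<close>

lemma planar_eigenvalue_bound:
  fixes k m j :: nat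
  assumes k: "k \<ge> 2" and m: "m = (k - 1)\<^sup>2" and j: "1 \<le> j" "j \<le> k" "j \<le> m"
  shows "0 \<le> (- 1) ^ j * (real ((k - j) * ((m - j) choose (k - j - 1)))
             - real (j * ((m - j) choose (k - j)))) + real ((m - 1) choose (k - 2))"
proof -
  obtain l where l: "k = l + 2" using k by (metis add.commute le_Suc_ex)
  have ml: "m = (l + 1)\<^sup>2" using m l by simp
  \<comment> \<open>The ratio of the two binomial coefficients in the eigenvalue; note
    \<open>m - k + 1 = (k - 1) (k - 2) = (l + 1) l\<close>.\<close>
  have absorb: "(k - j) * ((m - j) choose (k - j)) = (l + 1) * l * ((m - j) choose (k - j - 1))"
    if "j < k"
  proof -
    define q where "q = k - j - 1"
    have q: "k = j + Suc q" using that by (simp add: q_def)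
    have "m - j - q = m - (l + 1)" using l q by linarith
    also have "\<dots> = (l + 1) * l" by (simp add: ml power2_eq_square)
    finally show ?thesis using Suc_times_binomial_Suc[of q "m - j"] by (simp add: q)
  qed
  \<comment> \<open>This is where \<open>m - 1 = k (k - 2)\<close> enters.\<close>
  have absorb_top: "(m - 1) choose l = (l + 2) * ((m - 2) choose (l - 1))" if "l \<ge> 1"
  proof -
    have e: "m - 1 = l * (l + 2)" by (simp add: ml power2_eq_square)
    have "l * ((m - 1) choose l) = (m - 1) * ((m - 2) choose (l - 1))"
      using binomial_absorption[of "l - 1" "m - 1"] that by (simp add: numeral_2_eq_2)
    also have "\<dots> = l * ((l + 2) * ((m - 2) choose (l - 1)))"
      by (simp only: e mult.assoc)
    finally have "l * ((m - 1) choose l) = l * ((l + 2) * ((m - 2) choose (l - 1)))" .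
    then show ?thesis using that by (simp only: mult_cancel1) simp
  qed
  have "j = 1 \<or> odd j \<and> j \<ge> 2 \<or> j = 2 \<or> even j \<and> j \<ge> 4"
    using j(1) by presburger
  then consider "j = 1" | "odd j" "j \<ge> 2" | "j = 2" | "even j" "j \<ge> 4" by blast
  then show ?thesis
  proof cases
    case 1
    have "(l + 1) * ((m - 1) choose (l + 1)) = (l + 1) * (l * ((m - 1) choose l))"
      using absorb 1 l by (simp add: algebra_simps)
    then have "(m - 1) choose (l + 1) = l * ((m - 1) choose l)"
      by (simp only: mult_cancel1) simp
    then show ?thesis using 1 l by (simp add: algebra_simps)
  next
    case 2
    have "(k - j) * ((m - j) choose (k - j - 1)) \<le> j * ((m - j) choose (k - j))"
    proof (cases "j = k")
      case False
      then have "j < k" using j by simp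
      have "(k - j) * ((k - j) * ((m - j) choose (k - j - 1))) \<le> l * (l * ((m - j) choose (k - j - 1)))"
        using 2 l by (intro mult_le_mono) auto
      also have "\<dots> \<le> j * (l + 1) * (l * ((m - j) choose (k - j - 1)))"
        using mult_le_mono[of 1 j l "l + 1"] j by (intro mult_le_mono1) simp
      also have "\<dots> = j * ((l + 1) * l * ((m - j) choose (k - j - 1)))"
        by (simp only: mult.assoc)
      also have "\<dots> = (k - j) * (j * ((m - j) choose (k - j)))"
        using absorb[OF \<open>j < k\<close>] by (metis mult.left_commute)
      finally show ?thesis using \<open>j < k\<close> by simp
    qed simp
    then have "real ((k - j) * ((m - j) choose (k - j - 1))) \<le> real (j * ((m - j) choose (k - j)))"
      by (rule of_nat_mono)
    then show ?thesis using 2 by simp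
  next
    case 3
    then have "l \<ge> 1" using j ml by (cases l) auto
    have "l * ((m - 2) choose l) = l * ((l + 1) * ((m - 2) choose (l - 1)))"
      using absorb 3 l \<open>l \<ge> 1\<close> by (simp add: algebra_simps)
    then have "(m - 2) choose l = (l + 1) * ((m - 2) choose (l - 1))"
      using \<open>l \<ge> 1\<close> by (simp only: mult_cancel1) simp
    then show ?thesis using 3 l absorb_top[OF \<open>l \<ge> 1\<close>] by (simp add: algebra_simps)
  next
    case 4
    have "(m - j) choose (k - j) \<le> (m - 3) choose (k - 3)"
      using binomial_le_binomial_add[of "m - j" "k - j" "j - 3"] 4 j by simp
    also have "\<dots> \<le> (m - 2) choose (k - 3)"
      using 4 j by (intro binomial_right_mono) simp
    finally have "j * ((m - j) choose (k - j)) \<le> k * ((m - 2) choose (k - 3))"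
      using j by (intro mult_le_mono) auto
    also have "\<dots> = (m - 1) choose (k - 2)"
      using absorb_top l 4 j by simp
    finally have "real (j * ((m - j) choose (k - j))) \<le> real ((m - 1) choose (k - 2))"
      by (rule of_nat_mono)
    then show ?thesis using 4 by (simp add: add_increasing algebra_simps)
  qed
qed

section \<open>Eigenfunctions with many symmetries\<close>

lemma transpose_image_exchange:
  assumes "a \<in> F" "b \<notin> F"
  shows "transpose a b ` F = insert b (F - {a})"
proof -
  have "transpose a b ` (insert a (F - {a})) = insert b (F - {a})"
    using assms by (subst image_insert) (auto simp: transpose_def image_iff)
  then show ?thesis using assms by (simp add: insert_absorb)
qed

lemma bij_betw_transpose_nsets:
  assumes "a \<in> X" "b \<in> X"
  shows "bij_betw ((`) (transpose a b)) (nsets X k) (nsets X k)"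
  using bij_betw_transpose_iff assms by (intro bij_betw_nsets) auto

lemma transpose_in_nsets:
  assumes "a \<in> X" "b \<in> X" "F \<in> nsets X k"
  shows "transpose a b ` F \<in> nsets X k"
  using bij_betw_transpose_nsets[OF assms(1,2)] assms(3) by (auto simp: bij_betw_def)

text \<open>Kernels on the \<open>k\<close>-subsets that depend only on the size of the intersection are exactly those
invariant under all permutations of the ground set.\<close>

definition eigenfunction :: "'a set \<Rightarrow> nat \<Rightarrow> (nat \<Rightarrow> real) \<Rightarrow> real \<Rightarrow> ('a set \<Rightarrow> real) \<Rightarrow> bool" where
  "eigenfunction X k w lam f \<longleftrightarrow>
    (\<exists>F\<in>nsets X k. f F \<noteq> 0) \<and>
    (\<forall>F\<in>nsets X k. (\<Sum>G\<in>nsets X k. w (card (F \<inter> G)) * f G) = lam * f F)"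

text \<open>Only the values of \<open>s\<close> on \<open>T\<close> matter: \<open>s\<close> is a perfect matching of \<open>T\<close>, written as a
fixed-point-free involution. Compared with a list of ordered pairs, this leaves it open which end
of a pair a given set contains.\<close>

definition matching :: "('a \<Rightarrow> 'a) \<Rightarrow> 'a set \<Rightarrow> bool" where
  "matching s T \<longleftrightarrow> (\<forall>x\<in>T. s x \<in> T \<and> s x \<noteq> x \<and> s (s x) = x)"

definition antisymmetric_along :: "'a set set \<Rightarrow> ('a \<Rightarrow> 'a) \<Rightarrow> 'a set \<Rightarrow> ('a set \<Rightarrow> real) \<Rightarrow> bool" where
  "antisymmetric_along V s T f \<longleftrightarrow> (\<forall>x\<in>T. \<forall>F\<in>V. f (transpose x (s x) ` F) = - f F)"

definition symmetric_under :: "'a set set \<Rightarrow> 'a set \<Rightarrow> ('a set \<Rightarrow> real) \<Rightarrow> bool" where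
  "symmetric_under V Y f \<longleftrightarrow> (\<forall>c\<in>Y. \<forall>d\<in>Y. \<forall>F\<in>V. f (transpose c d ` F) = f F)"

lemma sum_transpose_kernel:
  fixes w :: "nat \<Rightarrow> real"
  assumes "a \<in> X" "b \<in> X"
  shows "(\<Sum>G\<in>nsets X k. w (card (F \<inter> G)) * f (transpose a b ` G))
       = (\<Sum>G\<in>nsets X k. w (card (transpose a b ` F \<inter> G)) * f G)"
proof -
  have "card (transpose a b ` F \<inter> transpose a b ` G) = card (F \<inter> G)" for G
    by (metis card_image image_Int inj_on_transpose)
  then show ?thesis
    by (subst sum.reindex_bij_betw[OF bij_betw_transpose_nsets[OF assms, of k], symmetric]) simp
qed

text \<open>The eigenspaces of an invariant kernel are invariant under permutations of the ground set, so they
contain this difference, which is antisymmetric in \<open>c\<close> and \<open>d\<close>.\<close>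

lemma antisymmetrize:
  assumes f: "eigenfunction X k w lam f" and cd: "c \<in> X" "d \<in> X"
    and F: "F \<in> nsets X k" "f (transpose c d ` F) \<noteq> f F"
  shows "eigenfunction X k w lam (\<lambda>F. f F - f (transpose c d ` F))"
  unfolding eigenfunction_def
proof (intro conjI ballI)
  show "\<exists>F\<in>nsets X k. f F - f (transpose c d ` F) \<noteq> 0" using F by force
  fix H assume H: "H \<in> nsets X k"
  show "(\<Sum>G\<in>nsets X k. w (card (H \<inter> G)) * (f G - f (transpose c d ` G)))
      = lam * (f H - f (transpose c d ` H))"
    using f H transpose_in_nsets[OF cd H]
    by (simp add: right_diff_distrib sum_subtractf sum_transpose_kernel[OF cd] eigenfunction_def)
qed

lemma transpose_image_commute:
  assumes "{a, b} \<inter> {c, d} = {}"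
  shows "transpose a b ` transpose c d ` F = transpose c d ` transpose a b ` F"
proof -
  have "transpose a b \<circ> transpose c d = transpose c d \<circ> transpose a b"
    using assms by (auto simp: transpose_def fun_eq_iff)
  then show ?thesis by (simp only: image_comp)
qed

text \<open>Antisymmetrising along a new pair preserves the antisymmetry along the old ones because disjoint
transpositions commute.\<close>

lemma antisymmetrize_along:
  assumes s: "matching s T" and f: "antisymmetric_along (nsets X k) s T f"
    and cd: "c \<in> X - T" "d \<in> X - T" "c \<noteq> d"
  shows "matching (s(c := d, d := c)) (insert c (insert d T))"
    and "antisymmetric_along (nsets X k) (s(c := d, d := c)) (insert c (insert d T))
           (\<lambda>F. f F - f (transpose c d ` F))"
proof -
  show "matching (s(c := d, d := c)) (insert c (insert d T))"
    using s cd by (auto simp: matching_def)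
  show "antisymmetric_along (nsets X k) (s(c := d, d := c)) (insert c (insert d T))
           (\<lambda>F. f F - f (transpose c d ` F))"
    unfolding antisymmetric_along_def
  proof (intro ballI)
    fix x F assume x: "x \<in> insert c (insert d T)" and F: "F \<in> nsets X k"
    show "f (transpose x ((s(c := d, d := c)) x) ` F)
          - f (transpose c d ` transpose x ((s(c := d, d := c)) x) ` F)
        = - (f F - f (transpose c d ` F))"
    proof (cases "x \<in> T")
      case True
      then have "{c, d} \<inter> {x, s x} = {}" using s cd by (auto simp: matching_def)
      then have "transpose c d ` transpose x (s x) ` F = transpose x (s x) ` transpose c d ` F"
        by (rule transpose_image_commute)
      moreover have "transpose c d ` F \<in> nsets X k" using cd F by (intro transpose_in_nsets) auto
      moreover have "x \<noteq> c" "x \<noteq> d" using True cd by auto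
      ultimately show ?thesis using f F True by (simp add: antisymmetric_along_def)
    next
      case False
      then have "transpose x ((s(c := d, d := c)) x) = transpose c d"
        using x by (auto simp: transpose_commute)
      then show ?thesis by (simp add: image_comp)
    qed
  qed
qed

text \<open>Antisymmetrise along one disjoint pair after another for as long as the result does not vanish.
When the process stops at \<open>T\<close>, every further difference \<open>f F - f (transpose c d ` F)\<close> vanishes,
which says that \<open>f\<close> does not distinguish the points outside \<open>T\<close>. The eigenvalue never changes.\<close>

lemma maximal_antisymmetrization:
  assumes X: "finite X" and f0: "eigenfunction X k w lam f0"
  obtains f s T where "eigenfunction X k w lam f" "T \<subseteq> X" "matching s T"
    "antisymmetric_along (nsets X k) s T f"
    "symmetric_under (nsets X k) (X - T) f"
proof -
  define P where "P T \<longleftrightarrow> T \<subseteq> X \<and> (\<exists>f s. eigenfunction X k w lam f \<and> matching s T \<and>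
      antisymmetric_along (nsets X k) s T f)" for T
  have "P {}" unfolding P_def using f0 by (auto simp: matching_def antisymmetric_along_def)
  moreover have "finite {T. P T}"
    by (rule finite_subset[of _ "Pow X"]) (auto simp: P_def X)
  ultimately obtain T where T: "P T" and max: "\<And>T'. P T' \<Longrightarrow> T \<subseteq> T' \<Longrightarrow> T' = T"
    using finite_has_maximal[of "{T. P T}"] by blast
  from T obtain f s where f: "eigenfunction X k w lam f" "matching s T"
    "antisymmetric_along (nsets X k) s T f" and "T \<subseteq> X" by (auto simp: P_def)
  have inv: "f (transpose c d ` F) = f F" if cd: "c \<in> X - T" "d \<in> X - T" and F: "F \<in> nsets X k" for c d F
  proof (rule ccontr)
    assume ne: "f (transpose c d ` F) \<noteq> f F"
    then have "c \<noteq> d" by auto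
    have "P (insert c (insert d T))"
      unfolding P_def
      using antisymmetrize[OF f(1) _ _ F ne] antisymmetrize_along[OF f(2,3) cd \<open>c \<noteq> d\<close>] cd \<open>T \<subseteq> X\<close>
      by blast
    then show False using max[of "insert c (insert d T)"] cd by blast
  qed
  show thesis
    by (rule that[OF f(1) \<open>T \<subseteq> X\<close> f(2,3)]) (use inv in \<open>auto simp: symmetric_under_def\<close>)
qed

section \<open>Values of a maximally antisymmetric function\<close>

definition transversal :: "('a \<Rightarrow> 'a) \<Rightarrow> 'a set \<Rightarrow> 'a set \<Rightarrow> bool" where
  "transversal s T F \<longleftrightarrow> (\<forall>x\<in>T. s x \<in> F \<longleftrightarrow> x \<notin> F)"

text \<open>If \<open>F\<close> contains both or neither of \<open>x\<close> and \<open>s x\<close>, then swapping them fixes \<open>F\<close> but negates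
\<open>f F\<close>.\<close>

lemma support_transversal:
  assumes "antisymmetric_along V s T f" "F \<in> V" "f F \<noteq> 0"
  shows "transversal s T F"
  unfolding transversal_def
proof (rule ballI, rule ccontr)
  fix x assume x: "x \<in> T" and "\<not> (s x \<in> F \<longleftrightarrow> x \<notin> F)"
  then have "transpose x (s x) ` F = F" by (intro transpose_image_eq) auto
  then have "f F = - f F" using assms x unfolding antisymmetric_along_def by metis
  then show False using assms by simp
qed

text \<open>The symmetries determine \<open>f\<close> up to a scalar: one transversal set is turned into another by
exchanging points, and an exchange changes the sign inside \<open>T\<close> and changes nothing outside.\<close>

lemma value_on_transversals:
  assumes s: "matching s T" "T \<subseteq> X" and anti: "antisymmetric_along (nsets X k) s T f"
    and inv: "symmetric_under (nsets X k) (X - T) f"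
    and G: "G \<in> nsets X k" "transversal s T G"
    and F: "F \<in> nsets X k" "transversal s T F"
  shows "f G = (-1) ^ card ((F - G) \<inter> T) * f F"
  using F
proof (induction "card (F - G)" arbitrary: F)
  case 0
  then have "F \<subseteq> G" by (auto simp: nsets_def)
  then have "F = G" using 0 G by (auto simp: nsets_def card_subset_eq)
  then show ?case by simp
next
  case (Suc q F)
  have fin: "finite F" "finite G" "F \<subseteq> X" "G \<subseteq> X" "card F = card G"
    using Suc.prems G by (auto simp: nsets_def)
  show ?case
  proof (cases "(F - G) \<inter> T = {}")
    case False
    then obtain x where x: "x \<in> F" "x \<notin> G" "x \<in> T" by blast
    \<comment> \<open>Transversality of \<open>G\<close> puts the partner \<open>s x\<close> into \<open>G\<close>, so this exchange moves \<open>F\<close> towards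
      \<open>G\<close>.\<close>
    define F' where "F' = insert (s x) (F - {x})"
    have sx: "s x \<notin> F" "s x \<in> G" "s x \<in> T"
      using x Suc.prems G s by (auto simp: transversal_def matching_def)
    have F': "F' = transpose x (s x) ` F" unfolding F'_def using x sx by (simp add: transpose_image_exchange)
    have diff: "F' - G = (F - G) - {x}" using x sx by (auto simp: F'_def)
    have "transversal s T F'"
      using Suc.prems(2) x sx s(1) unfolding transversal_def F'_def matching_def
      by (auto; metis)
    moreover have "F' \<in> nsets X k" unfolding F' using x sx s Suc.prems by (intro transpose_in_nsets) auto
    moreover have "q = card (F' - G)" unfolding diff using Suc.hyps(2) x fin by (simp add: card_Diff_singleton)
    ultimately have "f G = (-1) ^ card ((F' - G) \<inter> T) * f F'" using Suc.hyps(1) by blast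
    also have "f F' = - f F" unfolding F' using anti x Suc.prems by (auto simp: antisymmetric_along_def)
    finally have "f G = (-1) ^ Suc (card ((F' - G) \<inter> T)) * f F" by simp
    moreover have "card ((F - G) \<inter> T) = Suc (card ((F' - G) \<inter> T))"
    proof -
      have "(F - G) \<inter> T = insert x ((F' - G) \<inter> T)" unfolding diff using x by auto
      then show ?thesis using fin diff by (simp add: card_insert_if)
    qed
    ultimately show ?thesis by (simp only:)
  next
    case True
    have "F - G \<noteq> {}" using Suc.hyps(2) by (metis card.empty nat.distinct(1))
    then obtain x where x: "x \<in> F" "x \<notin> G" "x \<notin> T" using True by blast
    have "G - F \<noteq> {}" using fin x by (metis Diff_eq_empty_iff card_subset_eq)
    then obtain y where y: "y \<in> G" "y \<notin> F" by blast
    have "y \<notin> T"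
    proof
      assume "y \<in> T"
      then have "s y \<in> (F - G) \<inter> T"
        using y Suc.prems G s by (auto simp: transversal_def matching_def)
      then show False using True by blast
    qed
    \<comment> \<open>Inside \<open>T\<close> the sets \<open>F\<close> and \<open>G\<close> already agree; exchange two points outside.\<close>
    define F' where "F' = insert y (F - {x})"
    have F': "F' = transpose x y ` F" unfolding F'_def using x y by (simp add: transpose_image_exchange)
    have diff: "F' - G = (F - G) - {x}" using x y by (auto simp: F'_def)
    have "s z \<noteq> x \<and> s z \<noteq> y" if "z \<in> T" for z using that s(1) x \<open>y \<notin> T\<close> by (auto simp: matching_def)
    then have "transversal s T F'"
      using Suc.prems(2) x \<open>y \<notin> T\<close> unfolding transversal_def F'_def by auto
    moreover have "F' \<in> nsets X k" unfolding F' using x y fin Suc.prems by (intro transpose_in_nsets) auto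
    moreover have "q = card (F' - G)" unfolding diff using Suc.hyps(2) x fin by (simp add: card_Diff_singleton)
    ultimately have "f G = (-1) ^ card ((F' - G) \<inter> T) * f F'" using Suc.hyps(1) by blast
    also have "f F' = f F" unfolding F' using inv x y \<open>y \<notin> T\<close> fin Suc.prems
      by (auto simp: symmetric_under_def)
    also have "(F' - G) \<inter> T = (F - G) \<inter> T" unfolding diff using x by auto
    finally show ?thesis .
  qed
qed

lemma sum_antisymmetric_eq_0:
  assumes "matching s T" "T \<subseteq> X" "antisymmetric_along (nsets X k) s T f" "T \<noteq> {}"
  shows "(\<Sum>G\<in>nsets X k. f G) = 0"
proof -
  obtain x where x: "x \<in> T" using assms by blast
  have "(\<Sum>G\<in>nsets X k. f G) = (\<Sum>G\<in>nsets X k. f (transpose x (s x) ` G))"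
    using x assms by (intro sum.reindex_bij_betw[symmetric] bij_betw_transpose_nsets) (auto simp: matching_def)
  also have "\<dots> = (\<Sum>G\<in>nsets X k. - f G)"
    using assms x by (intro sum.cong) (auto simp: antisymmetric_along_def)
  finally show ?thesis by (simp add: sum_negf)
qed

lemma card_outside_matching:
  assumes s: "matching s T" "T \<subseteq> X" and X: "finite X"
    and F: "F \<in> nsets X k" "transversal s T F"
  shows "card (T - F) = card (F \<inter> T)" "card (F \<inter> T) \<le> k" "k + card (F \<inter> T) \<le> card X"
    "card (X - (F \<union> T)) = card X - k - card (F \<inter> T)"
    "card (F - T) = k - card (F \<inter> T)"
proof -
  have F': "finite F" "F \<subseteq> X" "card F = k" using F by (auto simp: nsets_def)
  have finT: "finite T" using s X finite_subset by blast
  have "bij_betw s (F \<inter> T) (T - F)"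
    using s(1) F(2) by (intro bij_betw_byWitness[where f' = s]) (auto simp: matching_def transversal_def)
  then show 1: "card (T - F) = card (F \<inter> T)" by (metis bij_betw_same_card)
  show "card (F \<inter> T) \<le> k" using F' by (metis card_mono inf_le1)
  show "card (F - T) = k - card (F \<inter> T)" using F' by (metis card_Diff_subset_Int finite_Int)
  have "card (F \<union> T) = card F + card (T - F)"
    using F' finT by (metis Un_Diff_cancel card_Un_disjoint Diff_disjoint finite_Diff)
  then have 2: "card (F \<union> T) = k + card (F \<inter> T)" using 1 F' by simp
  have sub: "F \<union> T \<subseteq> X" using F' s by auto
  show "k + card (F \<inter> T) \<le> card X" using card_mono[OF X sub] 2 by simp
  show "card (X - (F \<union> T)) = card X - k - card (F \<inter> T)"
    using card_Diff_subset[of "F \<union> T" X] sub 2 F' finT by simp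
qed

text \<open>This computes the eigenvalue by evaluating the eigenvalue equation at a set \<open>F\<close> in the support of
\<open>f\<close>. A transversal \<open>G\<close> with \<open>F \<inter> G = {v}\<close> has one of two shapes. If \<open>v\<close> lies outside \<open>T\<close>, then
\<open>G\<close> consists of all of \<open>T - F\<close>, the point \<open>v\<close> and \<open>k - j - 1\<close> points outside \<open>F \<union> T\<close>, and
differs from \<open>F\<close> on all \<open>j\<close> pairs. If \<open>v\<close> lies in \<open>T\<close>, then \<open>G\<close> consists of \<open>v\<close>, the points of
\<open>T - F\<close> other than the partner of \<open>v\<close>, and \<open>k - j\<close> points outside \<open>F \<union> T\<close>, and differs from
\<open>F\<close> on \<open>j - 1\<close> pairs. The two shapes therefore contribute with opposite signs.\<close>

lemma sum_over_sets_meeting_once: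
  assumes X: "finite X" and s: "matching s T" "T \<subseteq> X"
    and anti: "antisymmetric_along (nsets X k) s T f"
    and inv: "symmetric_under (nsets X k) (X - T) f"
    and F: "F \<in> nsets X k" "transversal s T F"
    and j: "j = card (F \<inter> T)" and m: "m = card X - k"
  shows "(\<Sum>G | G \<in> nsets X k \<and> card (F \<inter> G) = 1. f G)
       = (-1) ^ j * (real ((k - j) * ((m - j) choose (k - j - 1)))
                     - real (j * ((m - j) choose (k - j)))) * f F"
proof -
  define A B R Y where "A = F \<inter> T" and "B = T - F" and "R = F - T" and "Y = X - (F \<union> T)"
  note parts = A_def B_def R_def Y_def
  have F': "finite F" "F \<subseteq> X" "card F = k" using F by (auto simp: nsets_def)
  have fin: "finite A" "finite B" "finite R" "finite Y" "finite T"
    using X s F' finite_subset[OF s(2) X] by (auto simp: parts)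
  have cards: "card A = j" "card B = j" "card R = k - j" "card Y = m - j" "j \<le> k"
    using card_outside_matching[OF s X F] by (simp_all add: parts j m)
  have sAB: "s u \<in> B" if "u \<in> A" for u
    using that s F by (auto simp: parts matching_def transversal_def)
  \<comment> \<open>Parametrisations of the two shapes by the common point and the part outside \<open>F \<union> T\<close>.\<close>
  define g0 where "g0 = (\<lambda>(r, Z). insert r (B \<union> Z))"
  define g1 where "g1 = (\<lambda>(u, Z). insert u ((B - {s u}) \<union> Z))"
  define D0 where "D0 = R \<times> nsets Y (k - j - 1)"
  define D1 where "D1 = A \<times> nsets Y (k - j)"
  have val: "f G = (-1) ^ card (A - G) * f F" if "G \<in> nsets X k" "transversal s T G" for G
  proof -
    have "(F - G) \<inter> T = A - G" by (auto simp: parts)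
    then show ?thesis using value_on_transversals[OF s anti inv that F] by simp
  qed
  have S0: "G \<in> nsets X k \<and> card (F \<inter> G) = 1 \<and> f G = (-1) ^ j * f F \<and> F \<inter> G \<subseteq> R"
    if GD: "G \<in> g0 ` D0" for G
  proof -
    obtain r Z where rZ: "(r, Z) \<in> D0" "G = g0 (r, Z)" using GD by auto
    then have r: "r \<in> R" and Z: "Z \<subseteq> Y" "finite Z" "card Z = k - j - 1" and G: "G = insert r (B \<union> Z)"
      by (simp_all add: g0_def D0_def nsets_def)
    have "j < k" using cards r fin by (metis card_gt_0_iff empty_iff zero_less_diff)
    have "card (B \<union> Z) = j + (k - j - 1)"
      using Z fin cards by (subst card_Un_disjoint) (auto simp: parts)
    moreover have "r \<notin> B \<union> Z" using r Z by (auto simp: parts)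
    ultimately have "card G = k" using \<open>j < k\<close> fin Z G by simp
    then have V: "G \<in> nsets X k" using G r Z fin F' s by (auto simp: parts nsets_def)
    have FG: "F \<inter> G = {r}" using G r Z by (auto simp: parts)
    have GT: "x \<in> G \<longleftrightarrow> x \<in> B" if "x \<in> T" for x using G r Z that by (auto simp: parts)
    have "transversal s T G"
      unfolding transversal_def using GT F(2) s(1) by (auto simp: parts transversal_def matching_def)
    moreover have "A - G = A" using GT by (auto simp: parts)
    ultimately show ?thesis using V FG val[of G] cards r by simp
  qed
  have S1: "G \<in> nsets X k \<and> card (F \<inter> G) = 1 \<and> f G = (-1) ^ (j - 1) * f F \<and> F \<inter> G \<subseteq> A \<and> F \<inter> G \<noteq> {}"
    if GD: "G \<in> g1 ` D1" for G
  proof -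
    obtain u Z where uZ: "(u, Z) \<in> D1" "G = g1 (u, Z)" using GD by auto
    then have u: "u \<in> A" and Z: "Z \<subseteq> Y" "finite Z" "card Z = k - j"
      and G: "G = insert u ((B - {s u}) \<union> Z)"
      by (simp_all add: g1_def D1_def nsets_def)
    have "j > 0" using cards u fin by (metis card_gt_0_iff empty_iff)
    have "card ((B - {s u}) \<union> Z) = (j - 1) + (k - j)"
      using Z fin cards sAB[OF u] by (subst card_Un_disjoint) (auto simp: parts)
    moreover have "u \<notin> (B - {s u}) \<union> Z" using u Z by (auto simp: parts)
    ultimately have "card G = k" using \<open>j > 0\<close> cards(5) fin Z G by simp
    then have V: "G \<in> nsets X k" using G u Z fin F' s by (auto simp: parts nsets_def)
    have FG: "F \<inter> G = {u}" using G u Z by (auto simp: parts)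
    have GT: "x \<in> G \<longleftrightarrow> x = u \<or> x \<in> B \<and> x \<noteq> s u" if "x \<in> T" for x using G u Z that by (auto simp: parts)
    have "transversal s T G"
      unfolding transversal_def
    proof
      fix x assume x: "x \<in> T"
      then have "s x \<in> T" "s (s x) = x" "s u \<in> T" "s (s u) = u" "s u \<noteq> u"
        using s u by (auto simp: matching_def parts)
      then show "s x \<in> G \<longleftrightarrow> x \<notin> G"
        using GT x F(2) u by (auto simp: transversal_def parts)
    qed
    moreover have "A - G = A - {u}" using GT by (auto simp: parts)
    ultimately show ?thesis using V FG val[of G] cards u fin by simp
  qed
  have cover: "G \<in> g0 ` D0 \<union> g1 ` D1"
    if G: "G \<in> nsets X k" "card (F \<inter> G) = 1" "f G \<noteq> 0" for G
  proof -
    have trG: "transversal s T G" using support_transversal[OF anti] G by blast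
    have G': "finite G" "G \<subseteq> X" "card G = k" using G by (auto simp: nsets_def)
    obtain v where v: "F \<inter> G = {v}" using G(2) card_1_singletonE by blast
    define Z where "Z = G \<inter> Y"
    have Z: "Z \<subseteq> Y" "finite Z" using fin by (auto simp: Z_def)
    have BG: "x \<in> G \<longleftrightarrow> s x \<noteq> v" if "x \<in> B" for x
    proof -
      have "s x \<in> F" "s x \<in> T" "x \<in> T" using that s F by (auto simp: parts matching_def transversal_def)
      then show ?thesis using trG v by (auto simp: transversal_def)
    qed
    show ?thesis
    proof (cases "v \<in> T")
      case False
      then have "v \<in> R" using v by (auto simp: parts)
      have "B \<subseteq> G" using BG False s by (auto simp: parts matching_def)
      then have eq: "G = insert v (B \<union> Z)" using v False G' by (auto simp: parts Z_def)
      have "v \<notin> B \<union> Z" using \<open>v \<in> R\<close> by (auto simp: parts Z_def)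
      then have "k = Suc (card (B \<union> Z))" using eq G' by (metis card_insert_disjoint finite_insert)
      moreover have "card (B \<union> Z) = j + card Z"
        using Z fin cards by (subst card_Un_disjoint) (auto simp: parts)
      ultimately have "Z \<in> nsets Y (k - j - 1)" using Z by (simp add: nsets_def)
      then show ?thesis using eq \<open>v \<in> R\<close> by (auto simp: g0_def D0_def)
    next
      case True
      then have "v \<in> A" using v by (auto simp: parts)
      have "x \<in> G \<longleftrightarrow> x \<noteq> s v" if "x \<in> B" for x
        using BG[OF that] that s True by (auto simp: parts matching_def)
      then have eq: "G = insert v ((B - {s v}) \<union> Z)" using v G' by (auto simp: parts Z_def)
      have "v \<notin> (B - {s v}) \<union> Z" using \<open>v \<in> A\<close> by (auto simp: parts Z_def)
      then have "k = Suc (card ((B - {s v}) \<union> Z))" using eq G' by (metis card_insert_disjoint finite_insert)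
      moreover have "card ((B - {s v}) \<union> Z) = (j - 1) + card Z"
        using Z fin cards sAB[OF \<open>v \<in> A\<close>] by (subst card_Un_disjoint) (auto simp: parts)
      moreover have "j > 0" using cards \<open>v \<in> A\<close> fin by (metis card_gt_0_iff empty_iff)
      ultimately have "Z \<in> nsets Y (k - j)" using Z by (simp add: nsets_def)
      then show ?thesis using eq \<open>v \<in> A\<close> by (auto simp: g1_def D1_def)
    qed
  qed
  have inj0: "inj_on g0 D0"
  proof (rule inj_on_inverseI[where g = "\<lambda>G. (THE r. r \<in> G \<inter> R, G \<inter> Y)"])
    fix p assume "p \<in> D0"
    then obtain r Z where p: "p = (r, Z)" "r \<in> R" "Z \<subseteq> Y" by (auto simp: D0_def nsets_def)
    then have "g0 p \<inter> R = {r}" "g0 p \<inter> Y = Z" by (auto simp: g0_def parts)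
    then show "(THE r. r \<in> g0 p \<inter> R, g0 p \<inter> Y) = p" by (simp add: p(1))
  qed
  have inj1: "inj_on g1 D1"
  proof (rule inj_on_inverseI[where g = "\<lambda>G. (THE r. r \<in> G \<inter> A, G \<inter> Y)"])
    fix p assume "p \<in> D1"
    then obtain r Z where p: "p = (r, Z)" "r \<in> A" "Z \<subseteq> Y" by (auto simp: D1_def nsets_def)
    then have "g1 p \<inter> A = {r}" "g1 p \<inter> Y = Z" by (auto simp: g1_def parts)
    then show "(THE r. r \<in> g1 p \<inter> A, g1 p \<inter> Y) = p" by (simp add: p(1))
  qed
  have finD: "finite D0" "finite D1"
    using fin by (auto simp: D0_def D1_def finite_imp_finite_nsets)
  have "(\<Sum>G | G \<in> nsets X k \<and> card (F \<inter> G) = 1. f G) = (\<Sum>G\<in>g0 ` D0 \<union> g1 ` D1. f G)"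
  proof (rule sum.mono_neutral_right)
    show "finite {G \<in> nsets X k. card (F \<inter> G) = 1}"
      using X by (simp add: finite_imp_finite_nsets)
    show "g0 ` D0 \<union> g1 ` D1 \<subseteq> {G \<in> nsets X k. card (F \<inter> G) = 1}"
      using S0 S1 by blast
    show "\<forall>G\<in>{G \<in> nsets X k. card (F \<inter> G) = 1} - (g0 ` D0 \<union> g1 ` D1). f G = 0"
      using cover by blast
  qed
  also have "\<dots> = (\<Sum>G\<in>g0 ` D0. f G) + (\<Sum>G\<in>g1 ` D1. f G)"
  proof (rule sum.union_disjoint)
    show "g0 ` D0 \<inter> g1 ` D1 = {}"
    proof (rule equals0I)
      fix G assume G: "G \<in> g0 ` D0 \<inter> g1 ` D1"
      have "F \<inter> G \<subseteq> R" "F \<inter> G \<subseteq> A" "F \<inter> G \<noteq> {}"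
        using S0[of G] S1[of G] G by simp_all
      then show False by (auto simp: parts)
    qed
  qed (simp_all add: finD)
  also have "(\<Sum>G\<in>g0 ` D0. f G) = (\<Sum>G\<in>g0 ` D0. (-1) ^ j * f F)"
    using S0 by (intro sum.cong) blast+
  also have "(\<Sum>G\<in>g1 ` D1. f G) = (\<Sum>G\<in>g1 ` D1. (-1) ^ (j - 1) * f F)"
    using S1 by (intro sum.cong) blast+
  finally have total: "(\<Sum>G | G \<in> nsets X k \<and> card (F \<inter> G) = 1. f G)
      = (\<Sum>G\<in>g0 ` D0. (-1) ^ j * f F) + (\<Sum>G\<in>g1 ` D1. (-1) ^ (j - 1) * f F)" .
  have card0: "card (g0 ` D0) = (k - j) * ((m - j) choose (k - j - 1))"
    unfolding card_image[OF inj0] by (simp add: D0_def card_cartesian_product cards)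
  have card1: "card (g1 ` D1) = j * ((m - j) choose (k - j))"
    unfolding card_image[OF inj1] by (simp add: D1_def card_cartesian_product cards)
  have signs: "real p * ((-1) ^ j * y) + real (j * q) * ((-1) ^ (j - 1) * y)
      = (-1) ^ j * (real p - real (j * q)) * y" for p q y
    by (cases j) (simp_all add: algebra_simps)
  show ?thesis unfolding total sum_constant card0 card1 by (rule signs)
qed

section \<open>Positive semidefiniteness and the ratio bound\<close>

text \<open>The kernel is the matrix \<open>A + t I - c J\<close>, with \<open>A\<close> the adjacency matrix and \<open>J\<close> the all-ones
matrix: two \<open>k\<close>-sets coincide exactly when they share \<open>k\<close> points.\<close>

lemma sum_johnson_kernel:
  fixes f :: "'a set \<Rightarrow> real"
  assumes X: "finite X" and k: "k \<noteq> 1" and F: "F \<in> nsets X k"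
  shows "(\<Sum>G\<in>nsets X k. (of_bool (card (F \<inter> G) = 1) + t * of_bool (card (F \<inter> G) = k) - c) * f G)
       = (\<Sum>G | G \<in> nsets X k \<and> card (F \<inter> G) = 1. f G) + t * f F - c * (\<Sum>G\<in>nsets X k. f G)"
proof -
  have full: "card (F \<inter> G) = k \<longleftrightarrow> G = F" if "G \<in> nsets X k" for G
  proof -
    have "finite F" "finite G" "card F = k" "card G = k" using that F by (auto simp: nsets_def)
    then show ?thesis by (metis card_subset_eq inf.idem inf_le1 inf_le2)
  qed
  have V: "finite (nsets X k)" using X by (rule finite_imp_finite_nsets)
  have "(\<Sum>G\<in>nsets X k. (of_bool (card (F \<inter> G) = 1) + t * of_bool (card (F \<inter> G) = k) - c) * f G)
      = (\<Sum>G\<in>nsets X k. (if card (F \<inter> G) = 1 then f G else 0) + (if G = F then t * f G else 0) - c * f G)"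
    using full by (intro sum.cong) (auto simp: algebra_simps)
  also have "\<dots> = (\<Sum>G\<in>nsets X k. if card (F \<inter> G) = 1 then f G else 0) + t * f F - c * (\<Sum>G\<in>nsets X k. f G)"
    using V F by (simp add: sum.distrib sum_subtractf sum_distrib_left)
  also have "(\<Sum>G\<in>nsets X k. if card (F \<inter> G) = 1 then f G else 0) = (\<Sum>G | G \<in> nsets X k \<and> card (F \<inter> G) = 1. f G)"
    using V by (simp add: sum.inter_filter)
  finally show ?thesis .
qed

text \<open>The valency \<open>k * (n - k choose k - 1)\<close> of the graph is \<open>n - 1\<close> times \<open>\<tau>\<close>.\<close>

lemma valency_eq:
  fixes k :: nat
  assumes "k \<ge> 2"
  shows "k * ((k - 1)\<^sup>2 choose (k - 1)) = (k\<^sup>2 - k) * (((k - 1)\<^sup>2 - 1) choose (k - 2))"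
proof -
  obtain l where l: "k = Suc (Suc l)" using assms by (metis add_2_eq_Suc le_Suc_ex)
  have "Suc l * ((Suc l)\<^sup>2 choose Suc l) = Suc l * (Suc l * (((Suc l)\<^sup>2 - 1) choose l))"
    by (simp only: binomial_absorption power2_eq_square mult.assoc)
  then have "(Suc l)\<^sup>2 choose Suc l = Suc l * (((Suc l)\<^sup>2 - 1) choose l)"
    by (simp only: mult_cancel1) simp
  moreover have "k\<^sup>2 - k = k * Suc l" by (simp add: l power2_eq_square)
  ultimately show ?thesis by (simp add: l algebra_simps)
qed

text \<open>The constant \<open>c\<close> is the one for which the constant functions have eigenvalue 0. Any other
eigenvalue belongs to an eigenfunction that is antisymmetric along at least one pair, hence has sum
0, and is therefore \<open>t\<close> plus an eigenvalue of the graph.\<close>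

lemma johnson_eigenvalue_nonneg:
  fixes X :: "'a set" and k :: nat
  assumes X: "finite X" "card X = k\<^sup>2 - k + 1" and k: "k \<ge> 2"
    and t: "t = real (((k - 1)\<^sup>2 - 1) choose (k - 2))"
    and c: "c = real (card X) * t / real (card X choose k)"
    and f0: "eigenfunction X k (\<lambda>r. of_bool (r = 1) + t * of_bool (r = k) - c) lam f0"
  shows "0 \<le> lam"
proof -
  obtain f s T where f: "eigenfunction X k (\<lambda>r. of_bool (r = 1) + t * of_bool (r = k) - c) lam f"
    and s': "T \<subseteq> X" "matching s T" and anti: "antisymmetric_along (nsets X k) s T f"
    and inv: "symmetric_under (nsets X k) (X - T) f"
    by (rule maximal_antisymmetrization[OF X(1) f0])
  note s = s'(2,1)
  obtain F where F: "F \<in> nsets X k" "f F \<noteq> 0" using f by (auto simp: eigenfunction_def)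
  have tr: "transversal s T F" using support_transversal[OF anti F] .
  define m where "m = (k - 1)\<^sup>2"
  define j where "j = card (F \<inter> T)"
  have m: "m = card X - k"
    using k by (cases k) (auto simp: X(2) m_def power2_eq_square)
  have "F \<subseteq> X" "card F = k" using F by (auto simp: nsets_def)
  then have "k \<le> card X" using card_mono[OF X(1)] by blast
  note cards = card_outside_matching[OF s X(1) F(1) tr, folded j_def]
  have "lam * f F = (\<Sum>G | G \<in> nsets X k \<and> card (F \<inter> G) = 1. f G) + t * f F - c * (\<Sum>G\<in>nsets X k. f G)"
    using f F sum_johnson_kernel[OF X(1) _ F(1), of t c f] k by (simp add: eigenfunction_def)
  also have "(\<Sum>G | G \<in> nsets X k \<and> card (F \<inter> G) = 1. f G)
       = (-1) ^ j * (real ((k - j) * ((m - j) choose (k - j - 1)))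
                     - real (j * ((m - j) choose (k - j)))) * f F"
    by (rule sum_over_sets_meeting_once[OF X(1) s anti inv F(1) tr j_def m])
  finally have lam: "lam * f F = \<dots> + t * f F - c * (\<Sum>G\<in>nsets X k. f G)" .
  show ?thesis
  proof (cases "T = {}")
    case True
    have "f G = f F" if "G \<in> nsets X k" for G
      using value_on_transversals[OF s anti inv that _ F(1) tr] True by (simp add: transversal_def)
    then have "(\<Sum>G\<in>nsets X k. f G) = real (card X choose k) * f F" by simp
    moreover have "card X choose k > 0" using \<open>k \<le> card X\<close> by simp
    ultimately have "c * (\<Sum>G\<in>nsets X k. f G) = real (card X) * t * f F" by (simp add: c)
    moreover have "real (k * (m choose (k - 1))) = real (k\<^sup>2 - k) * t"
      unfolding m_def valency_eq[OF k] t by simp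
    moreover have "real (card X) = real (k\<^sup>2 - k) + 1" using X(2) by simp
    moreover have "j = 0" using True by (simp add: j_def)
    ultimately have "lam * f F = 0" using lam by (simp add: algebra_simps)
    then show ?thesis using F by simp
  next
    case False
    have "finite T" using s X finite_subset by blast
    have "j \<noteq> 0"
    proof
      assume "j = 0"
      then have "T - F = {}" "F \<inter> T = {}"
        using cards(1) \<open>finite T\<close> by (auto simp: j_def)
      then show False using False by blast
    qed
    have "lam * f F = ((-1) ^ j * (real ((k - j) * ((m - j) choose (k - j - 1)))
                     - real (j * ((m - j) choose (k - j)))) + t) * f F"
      using lam sum_antisymmetric_eq_0[OF s anti False] by (simp add: algebra_simps)
    then have "lam = (-1) ^ j * (real ((k - j) * ((m - j) choose (k - j - 1)))
                     - real (j * ((m - j) choose (k - j)))) + t" using F by simp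
    also have "\<dots> \<ge> 0"
      unfolding t m_def[symmetric] using \<open>j \<noteq> 0\<close> cards m k by (intro planar_eigenvalue_bound m_def) auto
    finally show ?thesis .
  qed
qed

lemma binomial_double_absorption:
  fixes k :: nat
  assumes "k \<ge> 2"
  shows "n * (n - 1) * ((n - 2) choose (k - 2)) = k * (k - 1) * (n choose k)"
proof -
  obtain l where l: "k = Suc (Suc l)" using assms by (metis add_2_eq_Suc le_Suc_ex)
  have "Suc (Suc l) * (Suc l * (n choose Suc (Suc l))) = Suc l * (n * ((n - 1) choose Suc l))"
    by (simp only: mult.left_commute binomial_absorption)
  also have "\<dots> = n * ((n - 1) * ((n - 2) choose l))"
    using binomial_absorption[of l "n - 1"] by (simp only: mult.left_commute[of "Suc l"]) (simp add: numeral_2_eq_2)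
  finally show ?thesis by (simp add: l algebra_simps)
qed

text \<open>Evaluate the positive semidefinite form \<open>A + t I - c J\<close> at the indicator function of \<open>S\<close>. The
adjacency part vanishes, which leaves \<open>0 \<le> t |S| - c |S|\<^sup>2\<close>, that is
\<open>|S| \<le> t / c = (n choose k) / n\<close>.\<close>

lemma card_family_avoiding_intersection_1:
  fixes X :: "'a set" and k :: nat
  assumes X: "finite X" "card X = k\<^sup>2 - k + 1" and k: "k \<ge> 2"
    and S: "S \<subseteq> nsets X k" "\<And>F G. F \<in> S \<Longrightarrow> G \<in> S \<Longrightarrow> card (F \<inter> G) \<noteq> 1"
  shows "card S \<le> (k\<^sup>2 - k - 1) choose (k - 2)"
proof -
  define n where "n = k\<^sup>2 - k + 1"
  define N where "N = card X choose k"
  define t where "t = real (((k - 1)\<^sup>2 - 1) choose (k - 2))"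
  define c where "c = real (card X) * t / real (card X choose k)"
  define w where "w r = of_bool (r = 1) + t * of_bool (r = k) - c" for r
  obtain l where l: "k = Suc (Suc l)" using k by (metis add_2_eq_Suc le_Suc_ex)
  have n: "n = l * l + 3 * l + 3" by (simp add: n_def l power2_eq_square)
  have V: "finite (nsets X k)" "card (nsets X k) = N"
    using X by (simp_all add: finite_imp_finite_nsets N_def)
  have "k \<le> n" by (simp add: n l)
  then have "N > 0" by (simp add: N_def X(2) n_def)
  have "t > 0" by (simp add: t_def l power2_eq_square)
  have "nsets X k \<noteq> {}" using V(2) \<open>N > 0\<close> by (metis card.empty less_irrefl)
  obtain lam f where f: "\<exists>F\<in>nsets X k. f F \<noteq> 0"
    "\<forall>F\<in>nsets X k. (\<Sum>G\<in>nsets X k. w (card (F \<inter> G)) * f G) = lam * f F"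
    and low: "\<And>g. lam * (\<Sum>F\<in>nsets X k. (g F)\<^sup>2) \<le> (\<Sum>F\<in>nsets X k. \<Sum>G\<in>nsets X k. w (card (F \<inter> G)) * g F * g G)"
    by (rule minimal_eigenvector_exists[OF V(1) \<open>nsets X k \<noteq> {}\<close>, of "\<lambda>F G. w (card (F \<inter> G))"])
      (auto simp: Int_commute)
  have "0 \<le> lam"
    by (rule johnson_eigenvalue_nonneg[OF X k t_def c_def, of lam f])
      (use f in \<open>simp add: eigenfunction_def w_def\<close>)
  define g where "g F = (of_bool (F \<in> S) :: real)" for F :: "'a set"
  have sumg: "(\<Sum>G\<in>nsets X k. g G) = card S"
    unfolding g_def using V S(1) by (simp add: sum.If_cases of_bool_def Int_absorb1)
  have "(\<Sum>G\<in>nsets X k. w (card (F \<inter> G)) * g F * g G) = g F * (t - c * card S)"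
    if F: "F \<in> nsets X k" for F
  proof (cases "F \<in> S")
    case True
    then have "(\<Sum>G | G \<in> nsets X k \<and> card (F \<inter> G) = 1. g G) = 0"
      using S(2) by (intro sum.neutral) (auto simp: g_def)
    then show ?thesis
      using sum_johnson_kernel[OF X(1) _ F, of t c g] k True by (simp add: w_def sumg) (simp add: g_def)
  qed (simp add: g_def)
  then have "(\<Sum>F\<in>nsets X k. \<Sum>G\<in>nsets X k. w (card (F \<inter> G)) * g F * g G) = card S * (t - c * card S)"
    by (simp add: sumg flip: sum_distrib_right)
  moreover have "0 \<le> lam * (\<Sum>F\<in>nsets X k. (g F)\<^sup>2)"
    using \<open>0 \<le> lam\<close> by (simp add: sum_nonneg)
  ultimately have "0 \<le> real (card S) * (t - c * card S)" using low[of g] by linarith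
  then have "card S = 0 \<or> c * card S \<le> t" by (auto simp: zero_le_mult_iff)
  then have "real n * real (card S) \<le> N"
  proof
    assume "c * card S \<le> t"
    moreover have "c = real n * t / N" by (simp add: c_def N_def X(2) n_def)
    ultimately have "t * (real n * real (card S)) \<le> t * real N"
      using \<open>N > 0\<close> by (simp add: field_simps)
    then show ?thesis using \<open>t > 0\<close> by simp
  qed simp
  then have "n * card S \<le> N" by (metis of_nat_le_iff of_nat_mult)
  moreover have "N = n * ((n - 2) choose (k - 2))"
  proof -
    \<comment> \<open>This identity, which for a projective plane of order \<open>k - 1\<close> counts the points on the lines
      through a point, turns \<open>(n choose k) / n\<close> into a single binomial coefficient.\<close>
    have "n - 1 = k * (k - 1)" by (simp add: n l)
    then have "(k * (k - 1)) * N = (k * (k - 1)) * (n * ((n - 2) choose (k - 2)))"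
      using binomial_double_absorption[OF k, of n]
      by (simp only: N_def X(2) n_def[symmetric] mult_ac)
    then show ?thesis using k by (simp only: mult_cancel1) simp
  qed
  moreover have "n > 0" by (simp add: n)
  ultimately have "card S \<le> (n - 2) choose (k - 2)" by simp
  moreover have "n - 2 = k\<^sup>2 - k - 1" by (simp add: n_def)
  ultimately show ?thesis by simp
qed

section \<open>The independence number\<close>

lemma card_nsets_through_pair:
  assumes X: "finite X" "a \<in> X" "b \<in> X" "a \<noteq> b" and k: "k \<ge> 2"
  shows "card {F \<in> nsets X k. a \<in> F \<and> b \<in> F} = (card X - 2) choose (k - 2)"
proof -
  have "{F \<in> nsets X k. a \<in> F \<and> b \<in> F} = (\<lambda>Z. insert a (insert b Z)) ` nsets (X - {a, b}) (k - 2)"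
  proof (intro equalityI subsetI)
    fix F assume F: "F \<in> {F \<in> nsets X k. a \<in> F \<and> b \<in> F}"
    then have "F - {a, b} \<in> nsets (X - {a, b}) (k - 2)"
      using X by (auto simp: nsets_def card_Diff_subset)
    moreover have "F = insert a (insert b (F - {a, b}))" using F by auto
    ultimately show "F \<in> (\<lambda>Z. insert a (insert b Z)) ` nsets (X - {a, b}) (k - 2)" by blast
  next
    fix F assume "F \<in> (\<lambda>Z. insert a (insert b Z)) ` nsets (X - {a, b}) (k - 2)"
    then obtain Z where Z: "F = insert a (insert b Z)" "Z \<subseteq> X - {a, b}" "finite Z" "card Z = k - 2"
      by (auto simp: nsets_def)
    then have "a \<notin> insert b Z" "b \<notin> Z" using X by auto
    then have "card F = k" using Z k by simp
    then show "F \<in> {F \<in> nsets X k. a \<in> F \<and> b \<in> F}" using Z X by (auto simp: nsets_def)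
  qed
  moreover have "inj_on (\<lambda>Z. insert a (insert b Z)) (nsets (X - {a, b}) (k - 2))"
    by (rule inj_on_inverseI[where g = "\<lambda>F. F - {a, b}"]) (auto simp: nsets_def)
  ultimately show ?thesis using X by (simp add: card_image card_Diff_subset numeral_2_eq_2)
qed

theorem theorem1:
  fixes k :: nat
  assumes "k > 1"
  shows "independence_number (johnson_graph (k\<^sup>2 - k + 1) k 1) = (k\<^sup>2 - k - 1) choose (k - 2)"
proof (rule antisym)
  have k: "k \<ge> 2" using assms by simp
  let ?X = "{1..k\<^sup>2 - k + 1}" and ?J = "johnson_graph (k\<^sup>2 - k + 1) k 1"
  obtain S where S: "independent_set ?J S" "card S = independence_number ?J"
    using independence_number_attained[OF finite_fst_johnson_graph] by blast
  have "card (F \<inter> G) \<noteq> 1" if "F \<in> S" "G \<in> S" for F G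
    using S(1) that k unfolding independent_set_johnson_graph_iff
    by (cases "F = G") (auto simp: nsets_def)
  then have "card S \<le> (k\<^sup>2 - k - 1) choose (k - 2)"
    using S(1) k by (intro card_family_avoiding_intersection_1[of ?X])
      (auto simp: independent_set_johnson_graph_iff)
  then show "independence_number ?J \<le> (k\<^sup>2 - k - 1) choose (k - 2)" using S by simp
next
  have k: "k \<ge> 2" using assms by simp
  let ?X = "{1..k\<^sup>2 - k + 1}" and ?J = "johnson_graph (k\<^sup>2 - k + 1) k 1"
  let ?S = "{F \<in> nsets ?X k. 1 \<in> F \<and> 2 \<in> F}"
  have "2 \<le> k\<^sup>2 - k + 1"
    using k by (cases k) (auto simp: power2_eq_square)
  then have "card ?S = (k\<^sup>2 - k - 1) choose (k - 2)"
    using card_nsets_through_pair[of ?X 1 2 k] k by simp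
  moreover have "card (F \<inter> G) \<noteq> 1" if "F \<in> ?S" "G \<in> ?S" for F G
  proof
    assume "card (F \<inter> G) = 1"
    then obtain v where "F \<inter> G = {v}" by (rule card_1_singletonE)
    then have "1 \<in> {v}" "2 \<in> {v}" using that by blast+
    then show False by simp
  qed
  then have "independent_set ?J ?S" by (auto simp: independent_set_johnson_graph_iff)
  then have "card ?S \<le> independence_number ?J"
    by (rule card_le_independence_number[OF finite_fst_johnson_graph])
  ultimately show "(k\<^sup>2 - k - 1) choose (k - 2) \<le> independence_number ?J" by simp
qed

end
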